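(* There exist a completely metrizable space $X$ and bounded metrics $d,d'$ on $X$, both compatible with the topology of $X$, such that the strong Choquet game $Ch(CL(X),H_d)$ is $\alpha$-favorable and the strong Choquet game $Ch(CL(X),H_{d'})$ is $\beta$-favorable.
   Context: For a metric space $(X,d)$, $CL(X)$ denotes the set of nonempty closed subsets of $X$. For $x\in X$ and $A\in CL(X)$, $d(x,A)=\inf\{d(x,a):a\in A\}$. The Hausdorff distance is $H_d(A_0,A_1)=\sup\{|d(x,A_0)-d(x,A_1)|:x\in X\}$ for $A_0,A_1\in CL(X)$; when $d$ is bounded it is a metric on $CL(X)$, and $(CL(X),H_d)$ carries the topology induced by it. A metric on $X$ is compatible if it induces the topology of $X$. A topological space is completely metrizable if its topology is induced by a complete metric. Strong Choquet game $Ch(Z)$ on a topological space $Z$ with an open base $\mathcal{B}$ (one may take $\mathcal{B}$ to be all open sets; the notions below do not depend on this choice): let $\mathcal{E}=\{(z,V)\in Z\times\mathcal{B}: z\in V\}$. Player $\beta$ starts by picking $(z_0,V_0)\in\mathcal{E}$, and player $\alpha$ responds with $U_0\in\mathcal{B}$ such that $z_0\in U_0\subseteq V_0$. Next $\beta$ picks $(z_1,V_1)\in\mathcal{E}$ with $V_1\subseteq U_0$, and $\alpha$ picks $U_1\in\mathcal{B}$ with $z_1\in U_1\subseteq V_1$, and so on. Player $\alpha$ wins the run $(z_0,V_0),U_0,(z_1,V_1),U_1,\dots$ if $\bigcap_n U_n=\bigcap_n V_n\neq\emptyset$; otherwise $\beta$ wins. A strategy for a player is a function assigning to each finite sequence of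 the opponent's previous choices (for $\beta$, including the empty sequence) a legal next move of that player; it is a winning strategy if the player wins every run compatible with it. $Ch(Z)$ is $\alpha$-favorable (resp. $\beta$-favorable) if $\alpha$ (resp. $\beta$) has a winning strategy in $Ch(Z)$. *)

theory Defs
  imports "HOL-Analysis.Analysis"
begin

definition compatible_metric :: "'a topology \<Rightarrow> ('a \<Rightarrow> 'a \<Rightarrow> real) \<Rightarrow> bool" where
  "compatible_metric X d \<longleftrightarrow>
     Metric_space (topspace X) d \<and> Metric_space.mtopology (topspace X) d = X"

definition CL :: "'a topology \<Rightarrow> 'a set set" where
  "CL X = {A. closedin X A \<and> A \<noteq> {}}"

definition dist_set :: "('a \<Rightarrow> 'a \<Rightarrow> real) \<Rightarrow> 'a \<Rightarrow> 'a set \<Rightarrow> real" where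
  "dist_set d x A = (INF a\<in>A. d x a)"

(* The value 0 off CL X is a convention: Metric_space demands symmetry and nonnegativity
   for all arguments of the type, not only for those in the carrier. *)
definition Hausdorff_dist ::
    "'a topology \<Rightarrow> ('a \<Rightarrow> 'a \<Rightarrow> real) \<Rightarrow> 'a set \<Rightarrow> 'a set \<Rightarrow> real" where
  "Hausdorff_dist X d A B =
     (if A \<in> CL X \<and> B \<in> CL X
      then (SUP x\<in>topspace X. \<bar>dist_set d x A - dist_set d x B\<bar>) else 0)"

(* Meaningful for bounded compatible d, see Metric_space_Hausdorff_dist below. *)
definition Hausdorff_hyperspace :: "'a topology \<Rightarrow> ('a \<Rightarrow> 'a \<Rightarrow> real) \<Rightarrow> 'a set topology" where
  "Hausdorff_hyperspace X d = Metric_space.mtopology (CL X) (Hausdorff_dist X d)"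

lemma Metric_space_Hausdorff_dist:
  assumes c: "compatible_metric X d" and b: "Metric_space.mbounded (topspace X) d (topspace X)"
  shows "Metric_space (CL X) (Hausdorff_dist X d)"
proof -
  interpret M: Metric_space "topspace X" d
    using c by (simp add: compatible_metric_def)
  have top: "M.mtopology = X"
    using c by (simp add: compatible_metric_def)
  obtain B where B: "\<And>x y. x \<in> topspace X \<Longrightarrow> y \<in> topspace X \<Longrightarrow> d x y \<le> B"
    using b by (auto simp: M.mbounded_alt)
  have bb: "bdd_below (d x ` A)" for x A
    by (rule bdd_belowI[of _ 0]) auto
  have CLD: "A \<subseteq> topspace X" "A \<noteq> {}" "closedin X A" if "A \<in> CL X" for A
    using that closedin_subset by (auto simp: CL_def)
  have nn: "0 \<le> dist_set d x A" if "A \<in> CL X" for x A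
    unfolding dist_set_def using CLD[OF that] by (intro cINF_greatest) auto
  have ub: "dist_set d x A \<le> B" if A: "A \<in> CL X" and x: "x \<in> topspace X" for x A
  proof -
    obtain a where a: "a \<in> A" "a \<in> topspace X" using CLD[OF A] by auto
    have "dist_set d x A \<le> d x a"
      unfolding dist_set_def by (rule cINF_lower[OF bb a(1)])
    then show ?thesis using B[OF x a(2)] by linarith
  qed
  have bdd: "bdd_above ((\<lambda>x. \<bar>dist_set d x A - dist_set d x C\<bar>) ` topspace X)"
    if "A \<in> CL X" "C \<in> CL X" for A C
  proof (rule bdd_aboveI2[of _ _ B])
    fix x assume x: "x \<in> topspace X"
    show "\<bar>dist_set d x A - dist_set d x C\<bar> \<le> B"
      using nn[OF that(1), of x] nn[OF that(2), of x] ub[OF that(1) x] ub[OF that(2) x] by linarith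
  qed
  have le: "\<bar>dist_set d x A - dist_set d x C\<bar> \<le> Hausdorff_dist X d A C"
    if "A \<in> CL X" "C \<in> CL X" "x \<in> topspace X" for A C x
    using that cSUP_upper[OF that(3) bdd[OF that(1,2)]] by (simp add: Hausdorff_dist_def)
  have ne: "topspace X \<noteq> {}" if "A \<in> CL X" for A
    using CLD[OF that] by auto
  have zero: "dist_set d x A = 0 \<longleftrightarrow> x \<in> A" if A: "A \<in> CL X" and x: "x \<in> topspace X" for x A
  proof
    assume xA: "x \<in> A"
    then have "dist_set d x A \<le> d x x"
      unfolding dist_set_def by (rule cINF_lower[OF bb])
    then show "dist_set d x A = 0" using nn[OF A, of x] x by simp
  next
    assume 0: "dist_set d x A = 0"
    show "x \<in> A"
    proof (rule ccontr)
      assume "x \<notin> A"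
      moreover have "closedin M.mtopology A" using CLD[OF A] by (simp add: top)
      ultimately obtain r where r: "r > 0" "disjnt A (M.mball x r)"
        using x by (auto simp: M.closedin_metric)
      have "r \<le> d x a" if "a \<in> A" for a
        using r that x CLD(1)[OF A] by (force simp: disjnt_iff)
      then have "r \<le> dist_set d x A"
        unfolding dist_set_def using CLD[OF A] by (intro cINF_greatest) auto
      then show False using 0 r by simp
    qed
  qed
  show ?thesis
  proof
    fix A C
    show "0 \<le> Hausdorff_dist X d A C"
    proof (cases "A \<in> CL X \<and> C \<in> CL X")
      case True
      then obtain x where "x \<in> topspace X" using ne by blast
      then show ?thesis using le[of A C x] True by linarith
    qed (auto simp: Hausdorff_dist_def)
    show "Hausdorff_dist X d A C = Hausdorff_dist X d C A"
      by (auto simp: Hausdorff_dist_def abs_minus_commute)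
  next
    fix A C assume AC: "A \<in> CL X" "C \<in> CL X"
    show "Hausdorff_dist X d A C = 0 \<longleftrightarrow> A = C"
    proof
      assume "Hausdorff_dist X d A C = 0"
      then have "dist_set d x A = dist_set d x C" if "x \<in> topspace X" for x
        using le[OF AC that] by simp
      then show "A = C"
        using zero AC CLD by (metis subset_antisym subset_iff)
    next
      assume "A = C" then show "Hausdorff_dist X d A C = 0"
        using ne[OF AC(1)] by (simp add: Hausdorff_dist_def)
    qed
  next
    fix A C D assume ACD: "A \<in> CL X" "C \<in> CL X" "D \<in> CL X"
    have "(SUP x\<in>topspace X. \<bar>dist_set d x A - dist_set d x D\<bar>)
            \<le> Hausdorff_dist X d A C + Hausdorff_dist X d C D"
    proof (rule cSUP_least[OF ne[OF ACD(1)]])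
      fix x assume x: "x \<in> topspace X"
      show "\<bar>dist_set d x A - dist_set d x D\<bar> \<le> Hausdorff_dist X d A C + Hausdorff_dist X d C D"
        using le[OF ACD(1,2) x] le[OF ACD(2,3) x] by linarith
    qed
    then show "Hausdorff_dist X d A D \<le> Hausdorff_dist X d A C + Hausdorff_dist X d C D"
      using ACD by (simp add: Hausdorff_dist_def)
  qed
qed

text \<open>The strong Choquet game, with the base consisting of all open sets. In the legality
  predicates, \<open>W\<close> is the preceding move of \<open>\<alpha>\<close> (\<open>topspace Z\<close> before \<open>\<beta>\<close>'s first move) and
  \<open>p = (z, V)\<close> is the preceding move of \<open>\<beta>\<close>.\<close>

definition legal_beta :: "'a topology \<Rightarrow> 'a set \<Rightarrow> 'a \<times> 'a set \<Rightarrow> bool" where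
  "legal_beta Z W p \<longleftrightarrow> openin Z (snd p) \<and> fst p \<in> snd p \<and> snd p \<subseteq> W"

definition legal_alpha :: "'a topology \<Rightarrow> 'a \<times> 'a set \<Rightarrow> 'a set \<Rightarrow> bool" where
  "legal_alpha Z p U \<longleftrightarrow> openin Z U \<and> fst p \<in> U \<and> U \<subseteq> snd p"

definition choquet_run :: "'a topology \<Rightarrow> (nat \<Rightarrow> 'a \<times> 'a set) \<Rightarrow> (nat \<Rightarrow> 'a set) \<Rightarrow> bool" where
  "choquet_run Z p U \<longleftrightarrow>
     (\<forall>n. legal_beta Z (if n = 0 then topspace Z else U (n - 1)) (p n) \<and> legal_alpha Z (p n) (U n))"

definition alpha_wins_run :: "(nat \<Rightarrow> 'a \<times> 'a set) \<Rightarrow> (nat \<Rightarrow> 'a set) \<Rightarrow> bool" where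
  "alpha_wins_run p U \<longleftrightarrow> (\<Inter>n. U n) = (\<Inter>n. snd (p n)) \<and> (\<Inter>n. snd (p n)) \<noteq> {}"

text \<open>A strategy takes the list of all previous moves of the opponent, in order of play. Its
  answer has to be legal whenever these moves were legal against the strategy itself.\<close>

definition alpha_strategy :: "'a topology \<Rightarrow> (('a \<times> 'a set) list \<Rightarrow> 'a set) \<Rightarrow> bool" where
  "alpha_strategy Z \<sigma> \<longleftrightarrow>
     (\<forall>ps. ps \<noteq> [] \<and>
           (\<forall>i<length ps. legal_beta Z (if i = 0 then topspace Z else \<sigma> (take i ps)) (ps ! i))
        \<longrightarrow> legal_alpha Z (last ps) (\<sigma> ps))"

definition beta_strategy :: "'a topology \<Rightarrow> ('a set list \<Rightarrow> 'a \<times> 'a set) \<Rightarrow> bool" where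
  "beta_strategy Z \<tau> \<longleftrightarrow>
     (\<forall>us. (\<forall>i<length us. legal_alpha Z (\<tau> (take i us)) (us ! i))
        \<longrightarrow> legal_beta Z (if us = [] then topspace Z else last us) (\<tau> us))"

definition alpha_favorable :: "'a topology \<Rightarrow> bool" where
  "alpha_favorable Z \<longleftrightarrow>
     (\<exists>\<sigma>. alpha_strategy Z \<sigma> \<and>
       (\<forall>p U. choquet_run Z p U \<and> (\<forall>n. U n = \<sigma> (map p [0..<Suc n])) \<longrightarrow> alpha_wins_run p U))"

definition beta_favorable :: "'a topology \<Rightarrow> bool" where
  "beta_favorable Z \<longleftrightarrow>
     (\<exists>\<tau>. beta_strategy Z \<tau> \<and>
       (\<forall>p U. choquet_run Z p U \<and> (\<forall>n. p n = \<tau> (map U [0..<n])) \<longrightarrow> \<not> alpha_wins_run p U))"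

end

theory Submission
  imports Defs
begin

text \<open>Take \<open>X\<close> to be a discrete space with continuum many points. For the metric with values 0
  and 1, two distinct closed sets are at Hausdorff distance 1, so the hyperspace is discrete and
  \<open>\<alpha>\<close> wins by answering \<open>(z, V)\<close> with \<open>{z}\<close> (\<open>Hausdorff_hyperspace_discrete_metric\<close>).

  For the other metric arrange the points of \<open>X\<close> in a comb: each point lies on one of continuum
  many teeth, indexed by the sequences \<open>s :: nat \<Rightarrow> nat\<close>, and has a height, a natural number, on its
  tooth. Different teeth are at distance 1, while along a tooth the points form a Cauchy sequence
  whose limit is missing. Among the closed sets, consider those that pick one height \<open>k s\<close> on every
  tooth. Raising the heights on all teeth that are already above level \<open>N\<close> moves such a set by at
  most \<open>1 / (N + 1)\<close>, regardless of how far they are raised. In each round \<open>\<beta>\<close> uses this freedom: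
  after \<open>\<alpha>\<close> has answered with an open set, \<open>\<beta>\<close> chooses a level \<open>N\<close> so large that raising from
  level \<open>N\<close> on stays in that open set, and raises each tooth \<open>s\<close> above that level up to the next
  entry of \<open>s\<close>. Since every sequence occurs as a tooth, one tooth happens to have as entries
  exactly the levels that \<open>\<beta>\<close> comes to use. On this tooth the heights are raised in every round and
  tend to infinity (\<open>escaping_tooth\<close>). As the open sets of \<open>\<beta>\<close> have radii tending to 0, a closed
  set in their intersection would have a point on this tooth, but none at any given height, so
  the intersection is empty (\<open>escaping_heights_no_limit\<close>).

  It matters that there are uncountably many teeth: with countably many, \<open>\<alpha>\<close> could protect one
  more tooth from escaping in each round.\<close>

section \<open>Estimates for the Hausdorff distance\<close>

lemma (in Metric_space) dist_set_le:
  "a \<in> A \<Longrightarrow> dist_set d x A \<le> d x a"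
  unfolding dist_set_def by (rule cINF_lower) (auto intro: bdd_belowI[of _ 0])

lemma (in Metric_space) dist_set_le_dist_set_add:
  assumes "x \<in> M" "A \<subseteq> M" "B \<subseteq> M" "A \<noteq> {}"
    and near: "\<And>a. a \<in> A \<Longrightarrow> \<exists>b\<in>B. d a b \<le> r"
  shows "dist_set d x B \<le> dist_set d x A + r"
proof -
  have "dist_set d x B - r \<le> d x a" if a: "a \<in> A" for a
  proof -
    obtain b where b: "b \<in> B" "d a b \<le> r" using near[OF a] by blast
    then have "d x b \<le> d x a + d a b"
      using assms a by (intro triangle) auto
    then show ?thesis
      using dist_set_le[OF b(1), of x] b(2) by linarith
  qed
  then have "dist_set d x B - r \<le> dist_set d x A"
    unfolding dist_set_def[of d x A] using \<open>A \<noteq> {}\<close> by (intro cINF_greatest) auto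
  then show ?thesis by simp
qed

lemma in_CL_D: "A \<in> CL X \<Longrightarrow> A \<subseteq> topspace X \<and> A \<noteq> {}"
  using closedin_subset by (auto simp: CL_def)

lemma Hausdorff_dist_le:
  assumes "Metric_space (topspace X) d" "A \<in> CL X" "B \<in> CL X"
    and "\<And>a. a \<in> A \<Longrightarrow> \<exists>b\<in>B. d a b \<le> r" "\<And>b. b \<in> B \<Longrightarrow> \<exists>a\<in>A. d b a \<le> r"
  shows "Hausdorff_dist X d A B \<le> r"
proof -
  interpret Metric_space "topspace X" d by fact
  have AB: "A \<subseteq> topspace X" "A \<noteq> {}" "B \<subseteq> topspace X" "B \<noteq> {}"
    using assms(2,3) in_CL_D by auto
  have "\<bar>dist_set d x A - dist_set d x B\<bar> \<le> r" if "x \<in> topspace X" for x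
    using dist_set_le_dist_set_add[OF that AB(1,3,2) assms(4)]
      dist_set_le_dist_set_add[OF that AB(3,1,4) assms(5)] by (simp add: abs_le_iff)
  moreover have "topspace X \<noteq> {}" using AB by auto
  ultimately show ?thesis
    using assms(2,3) by (auto simp: Hausdorff_dist_def intro: cSUP_least)
qed

lemma Hausdorff_dist_lessE:
  assumes "Metric_space (topspace X) d" "Metric_space.mbounded (topspace X) d (topspace X)"
    and "A \<in> CL X" "B \<in> CL X" "Hausdorff_dist X d A B < r" "a \<in> A"
  obtains b where "b \<in> B" "d a b < r"
proof -
  interpret Metric_space "topspace X" d by fact
  have AB: "A \<subseteq> topspace X" "A \<noteq> {}" "B \<subseteq> topspace X" "B \<noteq> {}"
    using assms(3,4) in_CL_D by auto
  obtain c where c: "\<And>x y. x \<in> topspace X \<Longrightarrow> y \<in> topspace X \<Longrightarrow> d x y \<le> c"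
    using assms(2) by (auto simp: mbounded_alt)
  have range: "0 \<le> dist_set d x C \<and> dist_set d x C \<le> c"
    if "x \<in> topspace X" "C \<subseteq> topspace X" "C \<noteq> {}" for x C
  proof
    show "0 \<le> dist_set d x C"
      unfolding dist_set_def using that by (intro cINF_greatest) auto
    show "dist_set d x C \<le> c"
      using that c dist_set_le by (meson order_trans subsetD equals0I)
  qed
  have a: "a \<in> topspace X" using AB assms by blast
  have "bdd_above ((\<lambda>x. \<bar>dist_set d x A - dist_set d x B\<bar>) ` topspace X)"
  proof (rule bdd_aboveI2)
    fix x assume "x \<in> topspace X"
    then show "\<bar>dist_set d x A - dist_set d x B\<bar> \<le> c"
      using range[of x A] range[of x B] AB by auto
  qed
  from cSUP_upper[OF a this]
  have "\<bar>dist_set d a A - dist_set d a B\<bar> < r"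
    using assms by (simp add: Hausdorff_dist_def)
  moreover have "dist_set d a A = 0"
    using range[of a A] dist_set_le[OF \<open>a \<in> A\<close>, of a] a AB by simp
  ultimately have "dist_set d a B < r" by simp
  moreover have "bdd_below (d a ` B)" by (auto intro: bdd_belowI[of _ 0])
  ultimately have "\<exists>b\<in>B. d a b < r"
    unfolding dist_set_def using AB(4) by (simp add: cINF_less_iff)
  then show ?thesis using that by blast
qed

section \<open>The favourable hyperspace\<close>

lemma alpha_favorable_discrete_topology: "alpha_favorable (discrete_topology Y)"
  unfolding alpha_favorable_def
proof (intro exI[of _ "\<lambda>ps. {fst (last ps)}"] conjI allI impI)
  show "alpha_strategy (discrete_topology Y) (\<lambda>ps. {fst (last ps)})"
    unfolding alpha_strategy_def
  proof (intro allI impI, elim conjE)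
    fix ps :: "('a \<times> 'a set) list"
    assume "ps \<noteq> []" and legal: "\<forall>i<length ps. legal_beta (discrete_topology Y)
      (if i = 0 then topspace (discrete_topology Y) else {fst (last (take i ps))}) (ps ! i)"
    then have "\<exists>W. legal_beta (discrete_topology Y) W (last ps)"
      by (metis last_conv_nth diff_less length_greater_0_conv zero_less_one)
    then show "legal_alpha (discrete_topology Y) (last ps) {fst (last ps)}"
      by (auto simp: legal_alpha_def legal_beta_def)
  qed
next
  fix p :: "nat \<Rightarrow> 'a \<times> 'a set" and U
  assume "choquet_run (discrete_topology Y) p U \<and> (\<forall>n. U n = {fst (last (map p [0..<Suc n]))})"
  then have run: "choquet_run (discrete_topology Y) p U" and U: "\<And>n. U n = {fst (p n)}"
    by auto
  have mem: "fst (p n) \<in> snd (p n)" for n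
    using run by (auto simp: choquet_run_def legal_beta_def)
  have sub: "snd (p (Suc n)) \<subseteq> {fst (p n)}" for n
    using run U[of n] by (force simp: choquet_run_def legal_beta_def)
  have const: "fst (p n) = fst (p 0)" for n
  proof (induction n)
    case (Suc n)
    then show ?case using mem[of "Suc n"] sub[of n] by auto
  qed simp
  have "U n = {fst (p 0)}" for n
    by (simp only: U const[of n])
  then have "(\<Inter>n. U n) = {fst (p 0)}" by simp
  moreover have "(\<Inter>n. snd (p n)) = {fst (p 0)}"
  proof
    show "(\<Inter>n. snd (p n)) \<subseteq> {fst (p 0)}" using sub[of 0] by blast
    have "fst (p 0) \<in> snd (p n)" for n using mem[of n] const[of n] by simp
    then show "{fst (p 0)} \<subseteq> (\<Inter>n. snd (p n))" by blast
  qed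
  ultimately show "alpha_wins_run p U"
    by (simp add: alpha_wins_run_def)
qed

lemma Hausdorff_hyperspace_discrete_metric:
  "Hausdorff_hyperspace (discrete_topology M) discrete_metric.dd
     = discrete_topology (CL (discrete_topology M))"
proof -
  let ?X = "discrete_topology M" and ?d = "discrete_metric.dd :: 'a \<Rightarrow> 'a \<Rightarrow> real"
  interpret discrete_metric M .
  have met: "Metric_space (topspace ?X) ?d" and bdd: "Metric_space.mbounded (topspace ?X) ?d (topspace ?X)"
    by (simp_all add: metric_M_dd mbounded_discrete_metric)
  interpret H: Metric_space "CL ?X" "Hausdorff_dist ?X ?d"
    by (rule Metric_space_Hausdorff_dist)
      (use met bdd mtopology_discrete_metric in \<open>auto simp: compatible_metric_def\<close>)
  have sub: "A \<subseteq> B" if AB: "A \<in> CL ?X" "B \<in> CL ?X" "Hausdorff_dist ?X ?d A B < 1" for A B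
  proof
    fix a assume "a \<in> A"
    then obtain b where "b \<in> B" "?d a b < 1"
      using Hausdorff_dist_lessE[OF met bdd AB] by blast
    then show "a \<in> B" by (simp add: dd_def split: if_splits)
  qed
  have "openin H.mtopology {A}" if A: "A \<in> CL ?X" for A
  proof -
    have "H.mball A 1 = {A}"
      using A sub H.commute by (fastforce simp: H.in_mball)
    then show ?thesis by (metis H.openin_mball)
  qed
  then show ?thesis
    unfolding Hausdorff_hyperspace_def
    by (metis H.topspace_mtopology discrete_topology_unique)
qed

section \<open>The comb metric\<close>

text \<open>The comb is laid out on an arbitrary type with enough points. Several points may share a
  tooth and a height: they still have positive distance from each other, so this does no harm.\<close>

locale comb =
  fixes code :: "'a \<Rightarrow> (nat \<Rightarrow> nat) \<times> nat"
  assumes surj_code: "surj code"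
begin

definition tooth :: "'a \<Rightarrow> nat \<Rightarrow> nat" where
  "tooth x = fst (code x)"

definition height :: "'a \<Rightarrow> nat" where
  "height x = snd (code x)"

text \<open>On a tooth this is an ultrametric in which every point is isolated, the point \<open>x\<close> by the
  radius \<open>1 / (height x + 1)\<close>, although the distance of high points is small.\<close>

definition comb_dist :: "'a \<Rightarrow> 'a \<Rightarrow> real" where
  "comb_dist x y =
     (if x = y then 0
      else if tooth x = tooth y then max (1 / (real (height x) + 1)) (1 / (real (height y) + 1))
      else 1)"

abbreviation X :: "'a topology" where
  "X \<equiv> discrete_topology UNIV"

lemma point_exists: obtains x where "tooth x = s" "height x = n"
  using surjD[OF surj_code, of "(s, n)"] by (metis fst_conv snd_conv tooth_def height_def)

lemma comb_dist_le_1: "comb_dist x y \<le> 1"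
  by (simp add: comb_dist_def)

lemma comb_dist_ge: "x \<noteq> y \<Longrightarrow> 1 / (real (height x) + 1) \<le> comb_dist x y"
  by (simp add: comb_dist_def)

lemma comb_dist_le:
  fixes N :: nat
  assumes "tooth x = tooth y" "N \<le> height x" "N \<le> height y"
  shows "comb_dist x y \<le> 1 / (real N + 1)"
  using assms by (simp add: comb_dist_def frac_le)

lemma tooth_eqI: "comb_dist x y < 1 \<Longrightarrow> tooth x = tooth y"
  by (auto simp: comb_dist_def split: if_splits)

lemma Metric_space_comb_dist: "Metric_space UNIV comb_dist"
proof
  fix x y z :: 'a
  have pos: "0 < comb_dist u v" if "u \<noteq> v" for u v
    by (rule less_le_trans[OF _ comb_dist_ge[OF that]]) simp
  then show "0 \<le> comb_dist x y"
    by (cases "x = y") (auto simp: comb_dist_def less_imp_le)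
  show "comb_dist x y = comb_dist y x"
    by (simp add: comb_dist_def max.commute)
  show "comb_dist x y = 0 \<longleftrightarrow> x = y"
    using pos[of x y] by (auto simp: comb_dist_def)
  show "comb_dist x z \<le> comb_dist x y + comb_dist y z"
  proof (cases "tooth x = tooth y \<and> tooth y = tooth z")
    case True
    define w where "w u = 1 / (real (height u) + 1)" for u
    have "0 \<le> w u" for u by (simp add: w_def)
    from this[of x] this[of y] this[of z] True show ?thesis
      unfolding comb_dist_def w_def[symmetric] by auto
  next
    case False
    then have "comb_dist x y = 1 \<or> comb_dist y z = 1"
      by (auto simp: comb_dist_def)
    moreover have "0 \<le> comb_dist x y" "0 \<le> comb_dist y z" "comb_dist x z \<le> 1"
      by (auto simp: comb_dist_def le_max_iff_disj)
    ultimately show ?thesis by linarith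
  qed
qed

lemma mbounded_comb_dist: "Metric_space.mbounded UNIV comb_dist UNIV"
  by (subst Metric_space.mbounded_alt[OF Metric_space_comb_dist]) (use comb_dist_le_1 in blast)

lemma compatible_comb_dist: "compatible_metric X comb_dist"
proof -
  interpret Metric_space UNIV comb_dist by (rule Metric_space_comb_dist)
  have "openin mtopology {x}" for x
  proof -
    have "mball x (1 / (real (height x) + 1)) = {x}"
      using comb_dist_ge[of x] by (fastforce simp: in_mball)
    then show ?thesis by (metis openin_mball)
  qed
  then have "mtopology = X"
    by (metis topspace_mtopology discrete_topology_unique)
  then show ?thesis by (simp add: compatible_metric_def Metric_space_comb_dist)
qed

abbreviation HX :: "'a set \<Rightarrow> 'a set \<Rightarrow> real" where
  "HX \<equiv> Hausdorff_dist X comb_dist"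

sublocale H: Metric_space "CL X" HX
  by (rule Metric_space_Hausdorff_dist[OF compatible_comb_dist])
    (simp add: mbounded_comb_dist)

lemma HX_le:
  assumes "A \<in> CL X" "B \<in> CL X"
    and "\<And>a. a \<in> A \<Longrightarrow> \<exists>b\<in>B. comb_dist a b \<le> r" "\<And>b. b \<in> B \<Longrightarrow> \<exists>a\<in>A. comb_dist b a \<le> r"
  shows "HX A B \<le> r"
  using assms by (intro Hausdorff_dist_le) (auto simp: Metric_space_comb_dist)

lemma HX_lessE:
  assumes "A \<in> CL X" "B \<in> CL X" "HX A B < r" "a \<in> A"
  obtains b where "b \<in> B" "comb_dist a b < r"
  by (rule Hausdorff_dist_lessE[OF _ _ assms])
    (auto simp: Metric_space_comb_dist mbounded_comb_dist)

section \<open>Closed sets with one height on every tooth\<close>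

definition height_graph :: "((nat \<Rightarrow> nat) \<Rightarrow> nat) \<Rightarrow> 'a set" where
  "height_graph k = {x. height x = k (tooth x)}"

definition raise :: "nat \<Rightarrow> nat \<Rightarrow> ((nat \<Rightarrow> nat) \<Rightarrow> nat) \<Rightarrow> (nat \<Rightarrow> nat) \<Rightarrow> nat" where
  "raise m N k = (\<lambda>s. if N \<le> k s then max (k s) (s m) else k s)"

lemma height_graph_in_CL: "height_graph k \<in> CL X"
proof -
  obtain x where "tooth x = undefined" "height x = k undefined" by (rule point_exists)
  then have "x \<in> height_graph k" by (simp add: height_graph_def)
  then show ?thesis by (auto simp: CL_def)
qed

lemma height_graph_close:
  fixes N :: nat
  assumes change: "\<And>s. k s \<noteq> l s \<Longrightarrow> N \<le> k s \<and> N \<le> l s" and x: "x \<in> height_graph k"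
  shows "\<exists>y\<in>height_graph l. comb_dist x y \<le> 1 / (real N + 1)"
proof (cases "k (tooth x) = l (tooth x)")
  case True
  then have "x \<in> height_graph l" using x by (simp add: height_graph_def)
  moreover have "comb_dist x x \<le> 1 / (real N + 1)" by (simp add: comb_dist_def)
  ultimately show ?thesis by blast
next
  case False
  obtain y where y: "tooth y = tooth x" "height y = l (tooth x)" by (rule point_exists)
  then have "comb_dist x y \<le> 1 / (real N + 1)"
    using change[OF False] x by (intro comb_dist_le) (auto simp: height_graph_def)
  moreover have "y \<in> height_graph l" using y by (simp add: height_graph_def)
  ultimately show ?thesis by blast
qed

text \<open>The bound involves neither \<open>m\<close> nor the amount by which the heights grow: above level \<open>N\<close>
  a tooth has diameter at most \<open>1 / (real N + 1)\<close>.\<close>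

lemma HX_raise_le: "HX (height_graph k) (height_graph (raise m N k)) \<le> 1 / (real N + 1)"
proof (rule HX_le)
  fix x
  have change: "N \<le> k s \<and> N \<le> raise m N k s" if "raise m N k s \<noteq> k s" for s
    using that by (auto simp: raise_def split: if_splits)
  show "\<exists>y\<in>height_graph (raise m N k). comb_dist x y \<le> 1 / (real N + 1)"
    if "x \<in> height_graph k"
    by (rule height_graph_close[OF _ that]) (use change in fastforce)
  show "\<exists>y\<in>height_graph k. comb_dist x y \<le> 1 / (real N + 1)"
    if "x \<in> height_graph (raise m N k)"
    by (rule height_graph_close[OF _ that]) (use change in fastforce)
qed (fact height_graph_in_CL)+

lemma raise_stays_in_open:
  assumes "openin H.mtopology U" "height_graph k \<in> U"
  shows "\<exists>N\<ge>n. height_graph (raise m N k) \<in> U"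
proof -
  obtain r where r: "r > 0" "H.mball (height_graph k) r \<subseteq> U"
    using assms by (auto simp: H.openin_mtopology)
  obtain N0 :: nat where N0: "1 / r < N0" using reals_Archimedean2 by blast
  define N where "N = max n N0"
  have "1 / r < real N + 1" using N0 unfolding N_def by linarith
  then have "1 / (real N + 1) < r" using r(1) by (simp add: field_simps)
  then have "height_graph (raise m N k) \<in> H.mball (height_graph k) r"
    using HX_raise_le[of k m N] height_graph_in_CL by (simp add: H.in_mball)
  then show ?thesis using r(2) unfolding N_def by (meson max.cobounded1 subsetD)
qed

section \<open>The strategy that lets one tooth escape\<close>

definition level :: "nat \<Rightarrow> ((nat \<Rightarrow> nat) \<Rightarrow> nat) \<Rightarrow> 'a set set \<Rightarrow> nat" where
  "level n k U = (SOME N. n \<le> N \<and> height_graph (raise (Suc n) N k) \<in> U)"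

lemma level:
  assumes "openin H.mtopology U" "height_graph k \<in> U"
  shows "n \<le> level n k U" "height_graph (raise (Suc n) (level n k U) k) \<in> U"
  using someI_ex[OF raise_stays_in_open[OF assms, of n "Suc n"]] by (auto simp: level_def)

primrec heights :: "(nat \<Rightarrow> 'a set set) \<Rightarrow> nat \<Rightarrow> (nat \<Rightarrow> nat) \<Rightarrow> nat" where
  "heights U 0 = (\<lambda>s. s 0)"
| "heights U (Suc n) = raise (Suc n) (level n (heights U n) (U n)) (heights U n)"

text \<open>The heights in round \<open>n\<close> depend on the first \<open>n\<close> answers of \<open>\<alpha>\<close> only; this makes them available
  to a strategy, which sees just a finite list.\<close>

lemma heights_cong: "(\<And>i. i < n \<Longrightarrow> U i = W i) \<Longrightarrow> heights U n = heights W n"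
  by (induction n) auto

text \<open>The ball makes the open sets of a run shrink towards a single possible limit, which
  intersecting with the last answer of \<open>\<alpha>\<close> would not guarantee.\<close>

definition beta_move :: "'a set set list \<Rightarrow> 'a set \<times> 'a set set" where
  "beta_move us =
     (let A = height_graph (heights (nth us) (length us))
      in (A, (if us = [] then CL X else last us) \<inter> H.mball A (1 / (real (length us) + 1))))"

lemma fst_beta_move: "fst (beta_move us) = height_graph (heights (nth us) (length us))"
  by (simp add: beta_move_def Let_def)

lemma beta_strategy_beta_move: "beta_strategy H.mtopology beta_move"
  unfolding beta_strategy_def
proof (intro allI impI)
  fix us
  assume legal: "\<forall>i<length us. legal_alpha H.mtopology (beta_move (take i us)) (us ! i)"
  define A where "A = height_graph (heights (nth us) (length us))"
  define W where "W = (if us = [] then CL X else last us)"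
  have W: "openin H.mtopology W \<and> A \<in> W"
  proof (cases us rule: rev_cases)
    case Nil
    then show ?thesis
      using openin_topspace[of H.mtopology] by (simp add: W_def A_def height_graph_in_CL)
  next
    case (snoc vs U)
    define k where "k = heights (nth vs) (length vs)"
    have k: "heights (nth us) (length vs) = k"
      unfolding k_def by (rule heights_cong) (simp add: snoc nth_append)
    have "legal_alpha H.mtopology (beta_move vs) U"
      using legal[rule_format, of "length vs"] by (simp add: snoc)
    then have U: "openin H.mtopology U" "height_graph k \<in> U"
      by (auto simp: legal_alpha_def fst_beta_move k_def)
    have "A = height_graph (raise (Suc (length vs)) (level (length vs) k U) k)"
      using k by (simp add: A_def snoc)
    then show ?thesis using level(2)[OF U] U(1) by (simp add: W_def snoc)
  qed
  have "beta_move us = (A, W \<inter> H.mball A (1 / (real (length us) + 1)))"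
    by (simp add: beta_move_def A_def W_def Let_def)
  then show "legal_beta H.mtopology (if us = [] then topspace H.mtopology else last us) (beta_move us)"
    using W height_graph_in_CL
    by (auto simp: legal_beta_def A_def W_def split: if_splits)
qed

text \<open>The tooth is the sequence of levels of the run itself. In each round it has just been raised
  to the level that is used in the next one, so that it takes part in every raise.\<close>

lemma escaping_tooth:
  assumes "\<And>n. openin H.mtopology (U n)" "\<And>n. height_graph (heights U n) \<in> U n"
  obtains s where "\<And>n. n \<le> heights U n s"
proof
  let ?s = "\<lambda>n. level n (heights U n) (U n)"
  have "?s n \<le> heights U n ?s" for n
    by (induction n) (auto simp: raise_def)
  then show "n \<le> heights U n ?s" for n
    using level(1)[OF assms, of n n] by (meson order_trans)
qed

text \<open>A point of \<open>B\<close> on the tooth \<open>s\<close> is isolated by a radius depending on its height, so it cannot be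
  approximated by points that climb beyond that height.\<close>

lemma escaping_heights_no_limit:
  assumes escape: "\<And>n. n \<le> k n s"
    and B: "\<And>n. B \<in> H.mball (height_graph (k n)) (1 / (real n + 1))"
  shows False
proof -
  have BCL: "B \<in> CL X" and close: "HX (height_graph (k n)) B < 1 / (real n + 1)" for n
    using B[of n] by (auto simp: H.in_mball)
  \<comment> \<open>The radius of the ball for \<open>n = 0\<close> is the distance between teeth, hence \<open>B\<close> meets the tooth \<open>s\<close>.\<close>
  obtain a where a: "tooth a = s" "height a = k 0 s" by (rule point_exists)
  then have "a \<in> height_graph (k 0)" by (simp add: height_graph_def)
  then obtain b where b: "b \<in> B" "comb_dist a b < 1"
    using HX_lessE[OF height_graph_in_CL BCL close[of 0]] by auto
  then have tooth_b: "tooth b = s" using tooth_eqI a by metis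
  \<comment> \<open>From round \<open>height b + 1\<close> on, the chosen sets lie above \<open>b\<close> on this tooth.\<close>
  define n where "n = Suc (height b)"
  have "HX B (height_graph (k n)) < 1 / (real n + 1)"
    using close[of n] by (simp add: H.commute)
  then obtain c where c: "c \<in> height_graph (k n)" "comb_dist b c < 1 / (real n + 1)"
    using HX_lessE[OF BCL height_graph_in_CL _ b(1)] by blast
  have "1 / (real n + 1) \<le> 1" by simp
  then have "comb_dist b c < 1" using c(2) by linarith
  then have "tooth c = s" using tooth_eqI tooth_b by metis
  then have "n \<le> height c" using c(1) escape[of n] by (simp add: height_graph_def)
  then have "b \<noteq> c" by (auto simp: n_def)
  then have "1 / (real (height b) + 1) < 1 / (real n + 1)"
    using comb_dist_ge[of b c] c(2) by simp
  then show False by (simp add: n_def field_simps)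
qed

theorem beta_favorable_comb: "beta_favorable (Hausdorff_hyperspace X comb_dist)"
  unfolding beta_favorable_def Hausdorff_hyperspace_def
proof (intro exI[of _ beta_move] conjI allI impI beta_strategy_beta_move)
  fix p U
  assume "choquet_run H.mtopology p U \<and> (\<forall>n. p n = beta_move (map U [0..<n]))"
  then have run: "choquet_run H.mtopology p U" and p: "\<And>n. p n = beta_move (map U [0..<n])"
    by auto
  have heights: "heights (nth (map U [0..<n])) n = heights U n" for n
    by (rule heights_cong) simp
  have centre: "fst (p n) = height_graph (heights U n)" for n
    by (simp add: p fst_beta_move heights)
  have ball: "snd (p n) \<subseteq> H.mball (height_graph (heights U n)) (1 / (real n + 1))" for n
    unfolding p beta_move_def Let_def by (simp add: heights add.commute)
  have "openin H.mtopology (U n)" "height_graph (heights U n) \<in> U n" for n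
    using run by (auto simp: choquet_run_def legal_alpha_def simp flip: centre)
  then obtain s where s: "\<And>n. n \<le> heights U n s"
    using escaping_tooth[of U] by blast
  have "B \<notin> (\<Inter>n. snd (p n))" for B
  proof
    assume "B \<in> (\<Inter>n. snd (p n))"
    then have "B \<in> H.mball (height_graph (heights U n)) (1 / (real n + 1))" for n
      using ball[of n] by blast
    from escaping_heights_no_limit[of "heights U", OF s this] show False .
  qed
  then have "(\<Inter>n. snd (p n)) = {}" by blast
  then show "\<not> alpha_wins_run p U" by (simp add: alpha_wins_run_def)
qed

end

section \<open>A comb on the reals\<close>

text \<open>A pair of a sequence and a number is coded by the graph of the sequence with the number
  prepended, and sets of natural numbers are equinumerous with the reals.\<close>

lemma surj_real_comb: "\<exists>code :: real \<Rightarrow> (nat \<Rightarrow> nat) \<times> nat. surj code"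
proof -
  obtain g :: "nat set \<Rightarrow> real" where g: "inj g"
    using nat_sets_eqpoll_reals by (auto simp: eqpoll_def bij_betw_def)
  define e :: "(nat \<Rightarrow> nat) \<times> nat \<Rightarrow> nat set" where
    "e = (\<lambda>(s, n). range (\<lambda>m. prod_encode (m, case_nat n s m)))"
  have "inj e"
  proof (rule injI, clarify)
    fix s n t l assume eq: "e (s, n) = e (t, l)"
    have "case_nat n s m = case_nat l t m" for m
    proof -
      have "prod_encode (m, case_nat n s m) \<in> e (t, l)"
        unfolding eq[symmetric] by (simp add: e_def)
      then show ?thesis by (auto simp: e_def)
    qed
    from this[of 0] this[of "Suc _"] show "s = t \<and> n = l" by auto
  qed
  then have "inj (g \<circ> e)" using g by (simp add: inj_compose)
  then show ?thesis using inj_imp_surj_inv by blast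
qed

theorem corollary3p2:
  shows "\<exists>(X :: real topology) (d :: real \<Rightarrow> real \<Rightarrow> real) (d' :: real \<Rightarrow> real \<Rightarrow> real).
    completely_metrizable_space X \<and>
    compatible_metric X d \<and> Metric_space.mbounded (topspace X) d (topspace X) \<and>
    compatible_metric X d' \<and> Metric_space.mbounded (topspace X) d' (topspace X) \<and>
    alpha_favorable (Hausdorff_hyperspace X d) \<and>
    beta_favorable (Hausdorff_hyperspace X d')"
proof -
  obtain code :: "real \<Rightarrow> (nat \<Rightarrow> nat) \<times> nat" where "surj code"
    using surj_real_comb by blast
  then interpret comb code by unfold_locales
  interpret disc: discrete_metric "UNIV :: real set" .
  show ?thesis
  proof (intro exI conjI)
    show "completely_metrizable_space X"
      by (rule completely_metrizable_space_discrete_topology)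
    show "compatible_metric X discrete_metric.dd"
      by (simp add: compatible_metric_def metric_M_dd disc.mtopology_discrete_metric)
    show "Metric_space.mbounded (topspace X) discrete_metric.dd (topspace X)"
      by (simp add: disc.mbounded_discrete_metric)
    show "compatible_metric X comb_dist"
      by (rule compatible_comb_dist)
    show "Metric_space.mbounded (topspace X) comb_dist (topspace X)"
      by (simp add: mbounded_comb_dist)
    show "alpha_favorable (Hausdorff_hyperspace X discrete_metric.dd)"
      by (simp add: Hausdorff_hyperspace_discrete_metric alpha_favorable_discrete_topology)
    show "beta_favorable (Hausdorff_hyperspace X comb_dist)"
      by (rule beta_favorable_comb)
  qed
qed

end
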